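(* Let $P\in\mathbb{P}_m(\mathbb{C}^{n\times n})$ be a regular $T$-even polynomial and let $(\lambda,x)\in\mathbb{C}\times\mathbb{C}^n$ be such that $\|x\|_2=1$ and $P(\lambda)x\ne0$. Let $\mathbb{S}_e$ and $\mathbb{S}_o$ denote the structures of $T$-even and $T$-odd pencils, respectively. Let $L_e\in\mathbb{L}_1(P)$ (resp. $L_o\in\mathbb{L}_1(P)$) be a $T$-even (resp. $T$-odd) linearization of $P$ with right ansatz vector $v$ satisfying $\|v\|_2=1$ and $v=\Sigma v$ (resp. $v=-\Sigma v$). Let $\Lambda_{m-1}:=[\lambda^{m-1},\ldots,\lambda,1]^T$. Then for $M\in\{2,F\}$: 1. If $|\lambda|\le1$ then $\displaystyle\sqrt{\frac{m+1}{2m}}\le\frac{\eta_M^{\mathbb{S}_e}(\lambda,\Lambda_{m-1}\otimes x,L_e;v)}{\eta(\lambda,x,P)}\le\sqrt2.$ 2. If $|\lambda|\ge1$ then $\displaystyle\sqrt{\frac{m+1}{2m}}\le\frac{\eta_M^{\mathbb{S}_o}(\lambda,\Lambda_{m-1}\otimes x,L_o;v)}{\eta(\lambda,x,P)}\le\sqrt2.$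
   Context: $m,n\ge1$ are integers. $\mathbb{P}_k(\mathbb{C}^{N\times N})$ is the vector space of matrix polynomials $Q(z)=\sum_{j=0}^k z^jA_j$, $A_j\in\mathbb{C}^{N\times N}$. $Q$ is regular if $\det Q(z)\not\equiv0$; $T$-even if $Q(z)^T=Q(-z)$ for all $z$; $T$-odd if $Q(z)^T=-Q(-z)$ for all $z$. $\Sigma:=\mathrm{diag}\{(-1)^{m-1},(-1)^{m-2},\ldots,(-1)^0\}$. For $M\in\{2,F\}$, $|||Q|||_M:=\left(\sum_{j=0}^k\|A_j\|_M^2\right)^{1/2}$ with $\|\cdot\|_F$ Frobenius and $\|\cdot\|_2$ spectral norm. For $Q\in\mathbb{P}_k(\mathbb{C}^{N\times N})$ regular, $\lambda\in\mathbb{C}$, $u\in\mathbb{C}^N\setminus\{0\}$: $\eta(\lambda,u,Q):=\inf\{|||\Delta Q|||_M:\Delta Q\in\mathbb{P}_k(\mathbb{C}^{N\times N}),\ Q(\lambda)u+\Delta Q(\lambda)u=0\}=\|Q(\lambda)u\|_2/(\|u\|_2\|[1,\lambda,\ldots,\lambda^k]^T\|_2)$ (the same for $M=2,F$), and for a structure class $\mathbb{S}\subset\mathbb{P}_k(\mathbb{C}^{N\times N})$ with $Q\in\mathbb{S}$, $\eta_M^{\mathbb{S}}(\lambda,u,Q):=\inf\{|||\Delta Q|||_M:\Delta Q\in\mathbb{S},\ Q(\lambda)u+\Delta Q(\lambda)u=0\}$. $\mathbb{L}_1(P)$ is the set of pencils $L(z)=zX+Y$, $X,Y\in\mathbb{C}^{mn\times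 mn}$, for which there is $v\in\mathbb{C}^m$ (the right ansatz vector of $L$) with $L(z)\,([z^{m-1},z^{m-2},\ldots,1]^T\otimes I_n)=v\otimes P(z)$ for all $z$; $\otimes$ is the Kronecker product. $L$ is a linearization of $P$ if there are unimodular matrix polynomials $E,F$ with $E(z)L(z)F(z)=\mathrm{diag}(P(z),I_{(m-1)n})$. Structured backward errors of $L_e$ (resp. $L_o$) are taken over all $T$-even (resp. $T$-odd) perturbation pencils in $\mathbb{P}_1(\mathbb{C}^{mn\times mn})$; the $v$ in $\eta_M^{\mathbb{S}}(\lambda,\cdot,L;v)$ only records the ansatz vector. *)

theory Defs
  imports
    "HOL-Analysis.L2_Norm"
    "Jordan_Normal_Form.Determinant"
begin

section \<open>Norms\<close>

definition vec_norm2 :: "complex vec \<Rightarrow> real" where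
  "vec_norm2 v = L2_set (\<lambda>i. cmod (v $ i)) {..<dim_vec v}"

definition frobenius_norm :: "complex mat \<Rightarrow> real" where
  "frobenius_norm A = sqrt (\<Sum>i<dim_row A. \<Sum>j<dim_col A. (cmod (A $$ (i, j)))\<^sup>2)"

text \<open>The spectral norm is the matrix norm induced by the Euclidean norm. Using the closed unit
  ball instead of the unit sphere keeps the supremum meaningful for matrices without columns.\<close>

definition spectral_norm :: "complex mat \<Rightarrow> real" where
  "spectral_norm A = Sup {vec_norm2 (A *\<^sub>v y) | y. y \<in> carrier_vec (dim_col A) \<and> vec_norm2 y \<le> 1}"

section \<open>Matrix polynomials\<close>

text \<open>A matrix polynomial is represented as a matrix over \<^typ>\<open>complex poly\<close>; the coefficient
  matrices and the values are obtained entrywise. The number \<open>k\<close> in \<open>matpolys k N\<close> is the grade: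
  the leading coefficient is allowed to vanish.\<close>

definition matpolys :: "nat \<Rightarrow> nat \<Rightarrow> complex poly mat set" where
  "matpolys k N = {Q \<in> carrier_mat N N. \<forall>i<N. \<forall>j<N. degree (Q $$ (i, j)) \<le> k}"

definition mp_coeff :: "complex poly mat \<Rightarrow> nat \<Rightarrow> complex mat" where
  "mp_coeff Q l = map_mat (\<lambda>p. coeff p l) Q"

definition mp_eval :: "complex poly mat \<Rightarrow> complex \<Rightarrow> complex mat" where
  "mp_eval Q z = map_mat (\<lambda>p. poly p z) Q"

lemma mp_eval_eq_sum:
  assumes "Q \<in> matpolys k N" "i < N" "j < N"
  shows "mp_eval Q z $$ (i, j) = (\<Sum>l\<le>k. z ^ l * mp_coeff Q l $$ (i, j))"
proof -
  let ?p = "Q $$ (i, j)"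
  have deg: "degree ?p \<le> k" and dims: "i < dim_row Q" "j < dim_col Q"
    using assms by (auto simp: matpolys_def)
  have "(\<Sum>l\<le>degree ?p. coeff ?p l * z ^ l) = (\<Sum>l\<le>k. coeff ?p l * z ^ l)"
    using deg by (intro sum.mono_neutral_left) (auto simp: coeff_eq_0)
  with dims show ?thesis
    by (simp add: mp_eval_def mp_coeff_def poly_altdef mult.commute)
qed

definition mp_regular :: "complex poly mat \<Rightarrow> bool" where
  "mp_regular Q \<longleftrightarrow> (\<exists>z. det (mp_eval Q z) \<noteq> 0)"

definition T_even_matpolys :: "nat \<Rightarrow> nat \<Rightarrow> complex poly mat set" where
  "T_even_matpolys k N = {Q \<in> matpolys k N. \<forall>z. transpose_mat (mp_eval Q z) = mp_eval Q (- z)}"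

definition T_odd_matpolys :: "nat \<Rightarrow> nat \<Rightarrow> complex poly mat set" where
  "T_odd_matpolys k N = {Q \<in> matpolys k N. \<forall>z. transpose_mat (mp_eval Q z) = - mp_eval Q (- z)}"

definition mp_norm :: "(complex mat \<Rightarrow> real) \<Rightarrow> nat \<Rightarrow> complex poly mat \<Rightarrow> real" where
  "mp_norm M k Q = sqrt (\<Sum>l\<le>k. (M (mp_coeff Q l))\<^sup>2)"

section \<open>Backward errors\<close>

text \<open>Here \<open>M\<close> is the underlying matrix norm, \<open>S\<close> the class of admissible perturbations, \<open>k\<close> the
  grade and \<open>u\<close> the approximate eigenvector, whose dimension is the size of \<open>Q\<close>.\<close>

definition structured_backward_error ::
    "(complex mat \<Rightarrow> real) \<Rightarrow> complex poly mat set \<Rightarrow> nat \<Rightarrow> complex \<Rightarrow> complex vec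
      \<Rightarrow> complex poly mat \<Rightarrow> real" where
  "structured_backward_error M S k lam u Q =
     Inf {mp_norm M k D | D. D \<in> S \<and>
       mp_eval Q lam *\<^sub>v u + mp_eval D lam *\<^sub>v u = 0\<^sub>v (dim_vec u)}"

definition backward_error ::
    "(complex mat \<Rightarrow> real) \<Rightarrow> nat \<Rightarrow> complex \<Rightarrow> complex vec \<Rightarrow> complex poly mat \<Rightarrow> real" where
  "backward_error M k lam u Q = structured_backward_error M (matpolys k (dim_vec u)) k lam u Q"

section \<open>Linearizations in the space of right ansatz pencils\<close>

definition kron_mat :: "'a :: semiring_0 mat \<Rightarrow> 'a mat \<Rightarrow> 'a mat" where
  "kron_mat A B = mat (dim_row A * dim_row B) (dim_col A * dim_col B)
     (\<lambda>(i, j). A $$ (i div dim_row B, j div dim_col B) * B $$ (i mod dim_row B, j mod dim_col B))"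

definition kron_vec :: "'a :: semiring_0 vec \<Rightarrow> 'a vec \<Rightarrow> 'a vec" where
  "kron_vec u w = vec (dim_vec u * dim_vec w) (\<lambda>i. u $ (i div dim_vec w) * w $ (i mod dim_vec w))"

definition col_mat :: "'a vec \<Rightarrow> 'a mat" where
  "col_mat u = mat_of_cols (dim_vec u) [u]"

lemma col_mat_kron_vec: "col_mat (kron_vec u w) = kron_mat (col_mat u) (col_mat w)"
proof (rule eq_matI)
  fix i j
  assume "i < dim_row (kron_mat (col_mat u) (col_mat w))"
    and "j < dim_col (kron_mat (col_mat u) (col_mat w))"
  then have i: "i < dim_vec u * dim_vec w" and j: "j = 0"
    by (auto simp: kron_mat_def col_mat_def)
  then have "i div dim_vec w < dim_vec u" and "i mod dim_vec w < dim_vec w"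
    by (auto simp: less_mult_imp_div_less intro!: mod_less_divisor gr0I)
  then show "col_mat (kron_vec u w) $$ (i, j) = kron_mat (col_mat u) (col_mat w) $$ (i, j)"
    using i j by (simp add: kron_mat_def kron_vec_def col_mat_def mat_of_cols_def)
qed (auto simp: kron_mat_def kron_vec_def col_mat_def)

text \<open>The vector \<open>[z ^ k, \<dots>, z, 1]\<close>, of length \<open>k + 1\<close>.\<close>

definition Lambda_vec :: "nat \<Rightarrow> complex \<Rightarrow> complex vec" where
  "Lambda_vec k z = vec (Suc k) (\<lambda>i. z ^ (k - i))"

definition right_ansatz_vector ::
    "nat \<Rightarrow> nat \<Rightarrow> complex poly mat \<Rightarrow> complex poly mat \<Rightarrow> complex vec \<Rightarrow> bool" where
  "right_ansatz_vector m n P L v \<longleftrightarrow> v \<in> carrier_vec m \<and>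
     (\<forall>z. mp_eval L z * kron_mat (col_mat (Lambda_vec (m - 1) z)) (1\<^sub>m n)
          = kron_mat (col_mat v) (mp_eval P z))"

definition L1_space :: "nat \<Rightarrow> nat \<Rightarrow> complex poly mat \<Rightarrow> complex poly mat set" where
  "L1_space m n P = {L \<in> matpolys 1 (m * n). \<exists>v. right_ansatz_vector m n P L v}"

text \<open>A square matrix polynomial is unimodular if its determinant is a nonzero constant, i.e. a unit
  of \<^typ>\<open>complex poly\<close>.\<close>

definition mp_unimodular :: "nat \<Rightarrow> complex poly mat \<Rightarrow> bool" where
  "mp_unimodular N E \<longleftrightarrow> E \<in> carrier_mat N N \<and> (\<exists>c. c \<noteq> 0 \<and> det E = [:c:])"

definition is_linearization :: "nat \<Rightarrow> nat \<Rightarrow> complex poly mat \<Rightarrow> complex poly mat \<Rightarrow> bool" where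
  "is_linearization m n P L \<longleftrightarrow> L \<in> matpolys 1 (m * n) \<and>
     (\<exists>E F. mp_unimodular (m * n) E \<and> mp_unimodular (m * n) F \<and>
        E * L * F = diag_block_mat [P, 1\<^sub>m ((m - 1) * n)])"

definition Sigma_mat :: "nat \<Rightarrow> complex mat" where
  "Sigma_mat m = mat_diag m (\<lambda>i. (- 1) ^ (m - 1 - i))"

end

theory Submission
  imports Defs
begin

text \<open>Put \<open>t = \<bar>\<lambda>\<bar>\<^sup>2\<close>, let \<open>u\<close> be the Kronecker product of \<open>\<Lambda>\<^bsub>m-1\<^esub>\<close> and \<open>x\<close>, and let
  \<open>R = \<parallel>P(\<lambda>)x\<parallel>\<close>. The ansatz equation gives \<open>\<parallel>L(\<lambda>)u\<parallel> = \<parallel>v\<parallel> R = R\<close>. By Cauchy-Schwarz, no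
  perturbation, structured or not, is smaller than \<open>R / (\<parallel>u\<parallel> sqrt (1 + t))\<close>. Conversely,
  splitting the residual into its component along \<open>cnj u\<close> and the rest
  yields an explicit \<open>T\<close>-even (\<open>T\<close>-odd) perturbation whose Frobenius
  norm exceeds this bound at most by the factor \<open>sqrt 2\<close>: the component along \<open>cnj u\<close> can only be
  corrected by the symmetric coefficient, at relative cost \<open>1\<close> (\<open>1 / t\<close>), which is at most
  \<open>2 / (1 + t)\<close> precisely when \<open>\<bar>\<lambda>\<bar> \<le> 1\<close> (\<open>\<bar>\<lambda>\<bar> \<ge> 1\<close>). As the spectral norm is dominated by
  the Frobenius norm, this settles both norms. The ratio is therefore between \<open>\<rho>\<close> and
  \<open>sqrt 2 \<rho>\<close> with \<open>\<rho>\<^sup>2 = (1 + \<dots> + t\<^sup>m) / ((1 + t) (1 + \<dots> + t\<^bsup>m-1\<^esup>))\<close>, and pairing \<open>t\<^sup>l\<close> with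
  \<open>t\<^bsup>m-l\<^esup>\<close> shows \<open>(m + 1) / (2 m) \<le> \<rho>\<^sup>2 \<le> 1\<close>.\<close>

section \<open>Norms\<close>

lemma vec_norm2_sq: "(vec_norm2 v)\<^sup>2 = (\<Sum>i<dim_vec v. (cmod (v $ i))\<^sup>2)"
  by (simp add: vec_norm2_def L2_set_def sum_nonneg)

lemma vec_norm2_nonneg [simp]: "0 \<le> vec_norm2 v"
  by (simp add: vec_norm2_def)

lemma vec_norm2_zero [simp]: "vec_norm2 (0\<^sub>v n) = 0"
  by (simp add: vec_norm2_def L2_set_def)

lemma vec_norm2_uminus [simp]: "vec_norm2 (- v) = vec_norm2 v"
  by (simp add: vec_norm2_def cong: L2_set_cong_simp)

lemma vec_norm2_smult: "vec_norm2 (c \<cdot>\<^sub>v v) = cmod c * vec_norm2 v"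
  by (simp add: vec_norm2_def norm_mult L2_set_right_distrib cong: L2_set_cong_simp)

lemma vec_norm2_pos:
  assumes "v \<in> carrier_vec n" "v \<noteq> 0\<^sub>v n"
  shows "0 < vec_norm2 v"
proof -
  obtain i where "i < n" "v $ i \<noteq> 0"
    using assms by (metis carrier_vecD dim_vec eq_vecI index_zero_vec(1) index_zero_vec(2))
  then have "0 < (vec_norm2 v)\<^sup>2"
    unfolding vec_norm2_sq using assms by (intro sum_pos2[of _ i]) auto
  then show ?thesis
    by (simp add: less_le)
qed

section \<open>Frobenius and spectral norms of matrices\<close>

lemma frobenius_norm_nonneg [simp]: "0 \<le> frobenius_norm A"
  by (simp add: frobenius_norm_def sum_nonneg)

text \<open>Cauchy-Schwarz in each row, then summation of the squares over all rows.\<close>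

lemma vec_norm2_mult_mat_vec_le_frobenius:
  assumes "y \<in> carrier_vec (dim_col A)"
  shows "vec_norm2 (A *\<^sub>v y) \<le> frobenius_norm A * vec_norm2 y"
proof (rule power2_le_imp_le)
  have "(cmod ((A *\<^sub>v y) $ i))\<^sup>2 \<le> (\<Sum>j<dim_col A. (cmod (A $$ (i, j)))\<^sup>2) * (vec_norm2 y)\<^sup>2"
    if i: "i < dim_row A" for i
  proof -
    let ?S = "{..<dim_col A}"
    have "(A *\<^sub>v y) $ i = (\<Sum>j<dim_col A. A $$ (i, j) * y $ j)"
      using assms i by (auto simp: scalar_prod_def lessThan_atLeast0 intro!: sum.cong)
    then have "cmod ((A *\<^sub>v y) $ i) \<le> (\<Sum>j\<in>?S. \<bar>cmod (A $$ (i, j))\<bar> * \<bar>cmod (y $ j)\<bar>)"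
      by (auto simp: norm_mult intro!: sum_norm_le)
    also have "\<dots> \<le> L2_set (\<lambda>j. cmod (A $$ (i, j))) ?S * L2_set (\<lambda>j. cmod (y $ j)) ?S"
      by (rule L2_set_mult_ineq)
    also have "L2_set (\<lambda>j. cmod (y $ j)) ?S = vec_norm2 y"
      using assms by (simp add: vec_norm2_def)
    finally have "(cmod ((A *\<^sub>v y) $ i))\<^sup>2 \<le> (L2_set (\<lambda>j. cmod (A $$ (i, j))) ?S * vec_norm2 y)\<^sup>2"
      by (rule power_mono) simp
    then show ?thesis
      by (simp add: power_mult_distrib L2_set_def sum_nonneg)
  qed
  then have "(vec_norm2 (A *\<^sub>v y))\<^sup>2
      \<le> (\<Sum>i<dim_row A. (\<Sum>j<dim_col A. (cmod (A $$ (i, j)))\<^sup>2) * (vec_norm2 y)\<^sup>2)"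
    unfolding vec_norm2_sq[of "A *\<^sub>v y"] by (auto intro!: sum_mono simp del: index_mult_mat_vec(1))
  also have "\<dots> = (frobenius_norm A * vec_norm2 y)\<^sup>2"
    by (simp add: frobenius_norm_def power_mult_distrib sum_nonneg sum_distrib_right)
  finally show "(vec_norm2 (A *\<^sub>v y))\<^sup>2 \<le> (frobenius_norm A * vec_norm2 y)\<^sup>2" .
qed simp

lemma vec_norm2_mult_mat_vec_le_frobenius_unit:
  assumes "y \<in> carrier_vec (dim_col A)" "vec_norm2 y \<le> 1"
  shows "vec_norm2 (A *\<^sub>v y) \<le> frobenius_norm A"
  using vec_norm2_mult_mat_vec_le_frobenius[OF assms(1)] assms(2)
    mult_left_mono[OF assms(2) frobenius_norm_nonneg[of A]] by simp

text \<open>Lets one Frobenius estimate of a perturbation serve for both choices of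
  \<open>M\<close>. The zero vector keeps the set under the supremum nonempty.\<close>

lemma spectral_norm_le_frobenius: "spectral_norm A \<le> frobenius_norm A"
  unfolding spectral_norm_def
proof (rule cSup_least)
  have "0\<^sub>v (dim_col A) \<in> carrier_vec (dim_col A) \<and> vec_norm2 (0\<^sub>v (dim_col A)) \<le> 1"
    by simp
  then show "{vec_norm2 (A *\<^sub>v y) | y. y \<in> carrier_vec (dim_col A) \<and> vec_norm2 y \<le> 1} \<noteq> {}"
    by blast
qed (auto intro: vec_norm2_mult_mat_vec_le_frobenius_unit)

lemma vec_norm2_mult_mat_vec_le_spectral_unit:
  assumes "y \<in> carrier_vec (dim_col A)" "vec_norm2 y \<le> 1"
  shows "vec_norm2 (A *\<^sub>v y) \<le> spectral_norm A"
  unfolding spectral_norm_def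
proof (rule cSup_upper)
  show "bdd_above {vec_norm2 (A *\<^sub>v y) | y. y \<in> carrier_vec (dim_col A) \<and> vec_norm2 y \<le> 1}"
    by (rule bdd_aboveI[of _ "frobenius_norm A"]) (auto intro: vec_norm2_mult_mat_vec_le_frobenius_unit)
qed (use assms in auto)

lemma spectral_norm_nonneg: "0 \<le> spectral_norm A"
  using vec_norm2_mult_mat_vec_le_spectral_unit[of "0\<^sub>v (dim_col A)" A] vec_norm2_nonneg order_trans
  by (metis vec_norm2_zero zero_carrier_vec zero_le_one)

text \<open>Rescaling \<open>y\<close> to length one reduces this to the defining supremum; only
  \<open>y = 0\<close> cannot be rescaled.\<close>

lemma vec_norm2_mult_mat_vec_le_spectral:
  assumes y: "y \<in> carrier_vec (dim_col A)"
  shows "vec_norm2 (A *\<^sub>v y) \<le> spectral_norm A * vec_norm2 y"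
proof (cases "y = 0\<^sub>v (dim_col A)")
  case True
  have "A *\<^sub>v 0\<^sub>v (dim_col A) = 0\<^sub>v (dim_row A)"
    by (intro eq_vecI) auto
  with True show ?thesis
    by simp
next
  case False
  let ?w = "vec_norm2 y"
  have w: "0 < ?w"
    using vec_norm2_pos[OF y False] .
  let ?y = "complex_of_real (inverse ?w) \<cdot>\<^sub>v y"
  have "vec_norm2 (A *\<^sub>v ?y) \<le> spectral_norm A"
    using y w by (intro vec_norm2_mult_mat_vec_le_spectral_unit)
      (auto simp: vec_norm2_smult norm_inverse simp flip: of_real_inverse)
  moreover have "A *\<^sub>v ?y = complex_of_real (inverse ?w) \<cdot>\<^sub>v (A *\<^sub>v y)"
    using y by (intro mult_mat_vec[of _ "dim_row A" "dim_col A"]) auto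
  ultimately have "inverse ?w * vec_norm2 (A *\<^sub>v y) \<le> spectral_norm A"
    using w by (simp add: vec_norm2_smult norm_inverse)
  with w show ?thesis
    by (simp add: field_simps)
qed

text \<open>Collects what the later arguments use about \<open>M\<close>, so that both norms are
  treated at once: compatibility with the Euclidean norm for lower bounds, domination by the
  Frobenius norm for upper bounds.\<close>

lemma matrix_norm_bounds:
  assumes "M \<in> {spectral_norm, frobenius_norm}"
  shows "0 \<le> M A" "M A \<le> frobenius_norm A"
    and "y \<in> carrier_vec (dim_col A) \<Longrightarrow> vec_norm2 (A *\<^sub>v y) \<le> M A * vec_norm2 y"
  using assms spectral_norm_nonneg spectral_norm_le_frobenius
    vec_norm2_mult_mat_vec_le_spectral vec_norm2_mult_mat_vec_le_frobenius
  by auto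

lemma L2_set_cmod_sum_le:
  assumes "finite B"
  shows "L2_set (\<lambda>i. cmod (\<Sum>l\<in>B. f l i)) A \<le> (\<Sum>l\<in>B. L2_set (\<lambda>i. cmod (f l i)) A)"
  using assms
proof induction
  case empty
  then show ?case by (simp add: L2_set_def)
next
  case (insert b B)
  have "L2_set (\<lambda>i. cmod (\<Sum>l\<in>insert b B. f l i)) A
      \<le> L2_set (\<lambda>i. cmod (f b i) + cmod (\<Sum>l\<in>B. f l i)) A"
    using insert by (intro L2_set_mono) (auto intro: norm_triangle_ineq)
  also have "\<dots> \<le> L2_set (\<lambda>i. cmod (f b i)) A + L2_set (\<lambda>i. cmod (\<Sum>l\<in>B. f l i)) A"
    by (rule L2_set_triangle_ineq)
  finally show ?case
    using insert by simp
qed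

text \<open>The entries are the powers of \<open>z\<close> in descending order; reversing the
  summation makes the exponents ascend.\<close>

lemma vec_norm2_Lambda_vec: "vec_norm2 (Lambda_vec k z) = L2_set (\<lambda>l. cmod z ^ l) {..k}"
proof -
  have "(\<Sum>i<Suc k. ((cmod z) ^ (k - i))\<^sup>2) = (\<Sum>l<Suc k. (cmod z ^ l)\<^sup>2)"
    using sum.nat_diff_reindex[of "\<lambda>l. (cmod z ^ l)\<^sup>2" "Suc k"] by simp
  then show ?thesis
    by (simp add: vec_norm2_def L2_set_def Lambda_vec_def norm_power lessThan_Suc_atMost)
qed

lemma vec_norm2_Lambda_vec_sq: "(vec_norm2 (Lambda_vec k z))\<^sup>2 = (\<Sum>l\<le>k. ((cmod z)\<^sup>2) ^ l)"
  by (simp add: vec_norm2_Lambda_vec L2_set_def sum_nonneg mult.commute flip: power_mult)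

lemma vec_norm2_Lambda_vec_pos: "0 < vec_norm2 (Lambda_vec k z)"
proof -
  have "0 < (vec_norm2 (Lambda_vec k z))\<^sup>2"
    unfolding vec_norm2_Lambda_vec_sq by (rule sum_pos2[of _ 0]) auto
  then show ?thesis
    by (simp add: less_le)
qed

section \<open>Backward errors\<close>

lemma dim_mp_eval [simp]: "dim_row (mp_eval Q z) = dim_row Q" "dim_col (mp_eval Q z) = dim_col Q"
  by (simp_all add: mp_eval_def)

lemma dim_mp_coeff [simp]: "dim_row (mp_coeff Q l) = dim_row Q" "dim_col (mp_coeff Q l) = dim_col Q"
  by (simp_all add: mp_coeff_def)

lemma mp_norm_nonneg: "0 \<le> mp_norm M k D"
  by (simp add: mp_norm_def sum_nonneg)

lemma mp_eval_mult_vec_index: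
  assumes "D \<in> matpolys k N" "u \<in> carrier_vec N" "i < N"
  shows "(mp_eval D z *\<^sub>v u) $ i = (\<Sum>l\<le>k. z ^ l * (mp_coeff D l *\<^sub>v u) $ i)"
proof -
  have D: "D \<in> carrier_mat N N"
    using assms by (simp add: matpolys_def)
  have "(mp_eval D z *\<^sub>v u) $ i = (\<Sum>j<N. mp_eval D z $$ (i, j) * u $ j)"
    using assms D by (auto simp: scalar_prod_def lessThan_atLeast0 mp_eval_def intro!: sum.cong)
  also have "\<dots> = (\<Sum>j<N. \<Sum>l\<le>k. z ^ l * (mp_coeff D l $$ (i, j) * u $ j))"
    using assms by (simp add: mp_eval_eq_sum sum_distrib_right mult.assoc)
  also have "\<dots> = (\<Sum>l\<le>k. z ^ l * (\<Sum>j<N. mp_coeff D l $$ (i, j) * u $ j))"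
    by (subst sum.swap) (simp add: sum_distrib_left)
  also have "\<dots> = (\<Sum>l\<le>k. z ^ l * (mp_coeff D l *\<^sub>v u) $ i)"
    using assms D by (auto simp: scalar_prod_def lessThan_atLeast0 mp_coeff_def intro!: sum.cong)
  finally show ?thesis .
qed

text \<open>Triangle inequality over the coefficients, followed by Cauchy-Schwarz between the norms
  of the coefficients and the powers of \<open>cmod z\<close>.\<close>

lemma vec_norm2_mp_eval_mult_vec_le:
  assumes M: "M \<in> {spectral_norm, frobenius_norm}"
    and D: "D \<in> matpolys k N" and u: "u \<in> carrier_vec N"
  shows "vec_norm2 (mp_eval D z *\<^sub>v u) \<le> mp_norm M k D * vec_norm2 (Lambda_vec k z) * vec_norm2 u"
proof -
  have dim: "dim_row D = N" "dim_col D = N"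
    using D by (auto simp: matpolys_def)
  have "vec_norm2 (mp_eval D z *\<^sub>v u)
      = L2_set (\<lambda>i. cmod (\<Sum>l\<le>k. z ^ l * (mp_coeff D l *\<^sub>v u) $ i)) {..<N}"
    unfolding vec_norm2_def
    using dim by (intro L2_set_cong) (auto simp: mp_eval_mult_vec_index[OF D u]
        simp del: index_mult_mat_vec(1))
  also have "\<dots> \<le> (\<Sum>l\<le>k. L2_set (\<lambda>i. cmod (z ^ l * (mp_coeff D l *\<^sub>v u) $ i)) {..<N})"
    by (rule L2_set_cmod_sum_le) simp
  also have "\<dots> = (\<Sum>l\<le>k. cmod z ^ l * vec_norm2 (mp_coeff D l *\<^sub>v u))"
    using dim by (simp add: vec_norm2_def norm_mult norm_power L2_set_right_distrib
        del: index_mult_mat_vec(1))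
  also have "\<dots> \<le> (\<Sum>l\<le>k. cmod z ^ l * (M (mp_coeff D l) * vec_norm2 u))"
    using u dim by (intro sum_mono mult_left_mono matrix_norm_bounds(3)[OF M])
      auto
  also have "\<dots> = (\<Sum>l\<le>k. \<bar>M (mp_coeff D l)\<bar> * \<bar>cmod z ^ l\<bar>) * vec_norm2 u"
    using matrix_norm_bounds(1)[OF M] by (simp add: sum_distrib_left mult_ac)
  also have "\<dots> \<le> (L2_set (\<lambda>l. M (mp_coeff D l)) {..k} * L2_set (\<lambda>l. cmod z ^ l) {..k}) * vec_norm2 u"
    by (intro mult_right_mono L2_set_mult_ineq) simp
  finally show ?thesis
    by (simp add: vec_norm2_Lambda_vec mp_norm_def L2_set_def)
qed

text \<open>Any admissible \<open>E\<close> satisfies \<open>E(z) u = - Q(z) u\<close>, so the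
  preceding estimate bounds its norm from below. The given \<open>D\<close> shows that the infimum
  is taken over a nonempty set.\<close>

lemma structured_backward_error_ge:
  assumes M: "M \<in> {spectral_norm, frobenius_norm}" and "S \<subseteq> matpolys k N"
    and Q: "Q \<in> carrier_mat N N" and u: "u \<in> carrier_vec N" "u \<noteq> 0\<^sub>v N"
    and D: "D \<in> S" "mp_eval Q z *\<^sub>v u + mp_eval D z *\<^sub>v u = 0\<^sub>v N"
  shows "vec_norm2 (mp_eval Q z *\<^sub>v u) / (vec_norm2 u * vec_norm2 (Lambda_vec k z))
    \<le> structured_backward_error M S k z u Q"
  unfolding structured_backward_error_def
proof (rule cInf_greatest)
  fix a assume "a \<in> {mp_norm M k D | D. D \<in> S \<and> mp_eval Q z *\<^sub>v u + mp_eval D z *\<^sub>v u = 0\<^sub>v (dim_vec u)}"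
  then obtain E where a: "a = mp_norm M k E" and E: "E \<in> matpolys k N"
    and eq: "mp_eval Q z *\<^sub>v u + mp_eval E z *\<^sub>v u = 0\<^sub>v N"
    using u assms(2) by auto
  have "mp_eval Q z *\<^sub>v u = - (mp_eval E z *\<^sub>v u)"
  proof (rule eq_vecI)
    fix i assume "i < dim_vec (- (mp_eval E z *\<^sub>v u))"
    then have i: "i < N"
      using E by (auto simp: matpolys_def)
    then have "(mp_eval Q z *\<^sub>v u + mp_eval E z *\<^sub>v u) $ i = 0"
      using eq by simp
    then show "(mp_eval Q z *\<^sub>v u) $ i = (- (mp_eval E z *\<^sub>v u)) $ i"
      using i E Q by (auto simp: matpolys_def add_eq_0_iff2 simp del: index_mult_mat_vec(1))
  qed (use E Q in \<open>auto simp: matpolys_def\<close>)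
  then have "vec_norm2 (mp_eval Q z *\<^sub>v u) \<le> a * vec_norm2 (Lambda_vec k z) * vec_norm2 u"
    using vec_norm2_mp_eval_mult_vec_le[OF M E u(1)] a by simp
  then show "vec_norm2 (mp_eval Q z *\<^sub>v u) / (vec_norm2 u * vec_norm2 (Lambda_vec k z)) \<le> a"
    using vec_norm2_pos[OF u] vec_norm2_Lambda_vec_pos[of k z] by (simp add: field_simps)
qed (use D u in auto)

lemma structured_backward_error_le:
  assumes "D \<in> S" "mp_eval Q z *\<^sub>v u + mp_eval D z *\<^sub>v u = 0\<^sub>v (dim_vec u)"
  shows "structured_backward_error M S k z u Q \<le> mp_norm M k D"
  unfolding structured_backward_error_def
  by (rule cInf_lower) (use assms in \<open>auto intro!: bdd_belowI[of _ 0] mp_norm_nonneg\<close>)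

section \<open>Perturbations with prescribed action and small norm\<close>

text \<open>Pythagoras for two vectors that are orthogonal in the Hermitian sense. The computation
  runs in the complex numbers, where a squared modulus is a product with the conjugate and both
  cross terms vanish.\<close>

lemma sum_cmod_sq_orthogonal:
  assumes "(\<Sum>j\<in>J. p j * cnj (q j)) = 0"
  shows "(\<Sum>j\<in>J. (cmod (a * p j + b * q j))\<^sup>2)
    = (cmod a)\<^sup>2 * (\<Sum>j\<in>J. (cmod (p j))\<^sup>2) + (cmod b)\<^sup>2 * (\<Sum>j\<in>J. (cmod (q j))\<^sup>2)"
proof -
  have conj: "(\<Sum>j\<in>J. q j * cnj (p j)) = 0"
    using arg_cong[OF assms, of cnj] by (simp add: mult.commute)
  have "complex_of_real (\<Sum>j\<in>J. (cmod (a * p j + b * q j))\<^sup>2)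
      = (\<Sum>j\<in>J. (a * cnj a) * (p j * cnj (p j)) + (b * cnj b) * (q j * cnj (q j))
          + (a * cnj b) * (p j * cnj (q j)) + (b * cnj a) * (q j * cnj (p j)))"
    unfolding of_real_sum complex_norm_square by (intro sum.cong) (simp_all add: algebra_simps)
  also have "\<dots> = (a * cnj a) * (\<Sum>j\<in>J. p j * cnj (p j)) + (b * cnj b) * (\<Sum>j\<in>J. q j * cnj (q j))"
    by (simp add: sum.distrib assms conj flip: sum_distrib_left)
  also have "\<dots> = complex_of_real ((cmod a)\<^sup>2 * (\<Sum>j\<in>J. (cmod (p j))\<^sup>2)
      + (cmod b)\<^sup>2 * (\<Sum>j\<in>J. (cmod (q j))\<^sup>2))"
    unfolding of_real_add of_real_mult of_real_sum complex_norm_square ..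
  finally show ?thesis
    by (simp only: of_real_eq_iff)
qed

lemma matpoly_of_coeffs:
  fixes A :: "nat \<Rightarrow> nat \<Rightarrow> nat \<Rightarrow> complex"
  obtains D where "D \<in> matpolys k N" "\<And>l. l \<le> k \<Longrightarrow> mp_coeff D l = mat N N (\<lambda>(i, j). A l i j)"
proof
  let ?D = "mat N N (\<lambda>(i, j). \<Sum>l\<le>k. monom (A l i j) l)"
  show "?D \<in> matpolys k N"
    by (auto simp: matpolys_def intro!: degree_sum_le order_trans[OF degree_monom_le])
  show "mp_coeff ?D l = mat N N (\<lambda>(i, j). A l i j)" if "l \<le> k" for l
    using that by (intro eq_matI) (auto simp: mp_coeff_def coeff_sum sum.delta)
qed

text \<open>With \<open>r = - Q(z) u\<close>, \<open>q = cnj u / \<parallel>u\<parallel>\<^sup>2\<close> and the orthogonal splitting \<open>r = s q + c\<close>, the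
  perturbation has the coefficients \<open>a\<^sub>l s q q\<^sup>T + b\<^sub>l c q\<^sup>T + g\<^sub>l q c\<^sup>T\<close>, whose three parts are
  mutually orthogonal in the Frobenius inner product.\<close>

lemma backward_perturbation:
  fixes a b g :: "nat \<Rightarrow> complex"
  assumes M: "M \<in> {spectral_norm, frobenius_norm}"
    and Q: "Q \<in> carrier_mat N N" and u: "u \<in> carrier_vec N" "u \<noteq> 0\<^sub>v N"
    and a: "(\<Sum>l\<le>k. z ^ l * a l) = 1" and b: "(\<Sum>l\<le>k. z ^ l * b l) = 1"
    and Ka: "(\<Sum>l\<le>k. (cmod (a l))\<^sup>2) \<le> K"
    and Kb: "(\<Sum>l\<le>k. (cmod (b l))\<^sup>2 + (cmod (g l))\<^sup>2) \<le> K"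
  obtains D where "D \<in> matpolys k N"
    and "mp_eval Q z *\<^sub>v u + mp_eval D z *\<^sub>v u = 0\<^sub>v N"
    and "mp_norm M k D \<le> sqrt K * vec_norm2 (mp_eval Q z *\<^sub>v u) / vec_norm2 u"
    and "\<And>e l. \<lbrakk>l \<le> k; a l = e * a l; g l = e * b l; b l = e * g l\<rbrakk>
      \<Longrightarrow> transpose_mat (mp_coeff D l) = e \<cdot>\<^sub>m mp_coeff D l"
proof -
  define \<omega> where "\<omega> = (vec_norm2 u)\<^sup>2"
  have \<omega>: "0 < \<omega>" "\<omega> = (\<Sum>i<N. (cmod (u $ i))\<^sup>2)"
    using vec_norm2_pos[OF u] by (simp add: \<omega>_def) (use u in \<open>simp add: \<omega>_def vec_norm2_sq\<close>)
  define r where "r i = - (mp_eval Q z *\<^sub>v u) $ i" for i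
  \<comment> \<open>Scaled so that the bilinear product of \<open>q\<close> and \<open>u\<close> is
    1; hence \<open>w q\<^sup>T\<close> maps \<open>u\<close> to \<open>w\<close>.\<close>
  define q where "q i = cnj (u $ i) / of_real \<omega>" for i
  \<comment> \<open>This coefficient makes the remainder \<open>c\<close> bilinearly orthogonal to
    \<open>u\<close>.\<close>
  define s where "s = (\<Sum>i<N. u $ i * r i)"
  define c where "c i = r i - s * q i" for i
  have \<omega>_cnj: "of_real \<omega> = (\<Sum>i<N. u $ i * cnj (u $ i))"
    unfolding \<omega>(2) of_real_sum complex_norm_square ..
  have qu: "(\<Sum>i<N. q i * u $ i) = 1"
    using \<omega>(1) by (simp add: q_def mult.commute \<omega>_cnj[symmetric] flip: sum_divide_distrib)
  have cu: "(\<Sum>i<N. c i * u $ i) = 0"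
    using qu by (simp add: c_def left_diff_distrib sum_subtractf s_def mult.assoc mult.commute[of "r _"]
        flip: sum_distrib_left)
  \<comment> \<open>Since \<open>q\<close> is a multiple of \<open>cnj u\<close>, bilinear
    orthogonality of \<open>c\<close> and \<open>u\<close> is Hermitian orthogonality of
    \<open>c\<close> and \<open>q\<close>.\<close>
  have qc: "(\<Sum>i<N. q i * cnj (c i)) = 0"
  proof -
    have "(\<Sum>i<N. q i * cnj (c i)) = cnj (\<Sum>i<N. c i * u $ i) / of_real \<omega>"
      by (simp add: q_def sum_divide_distrib mult.commute)
    then show ?thesis
      by (simp add: cu)
  qed
  have q2: "(\<Sum>i<N. (cmod (q i))\<^sup>2) = 1 / \<omega>"
  proof -
    have "(\<Sum>i<N. (cmod (q i))\<^sup>2) = \<omega> / \<omega>\<^sup>2"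
      using \<omega>(1) by (simp add: q_def norm_divide power_divide \<omega>(2)[symmetric]
          flip: sum_divide_distrib)
    then show ?thesis
      using \<omega> by (simp add: power2_eq_square)
  qed
  define C where "C = (\<Sum>i<N. (cmod (c i))\<^sup>2)"
  have C: "0 \<le> C"
    by (simp add: C_def sum_nonneg)
  define R where "R = vec_norm2 (mp_eval Q z *\<^sub>v u)"
  have R: "R\<^sup>2 = (cmod s)\<^sup>2 / \<omega> + C"
  proof -
    have "R\<^sup>2 = (\<Sum>i<N. (cmod (s * q i + 1 * c i))\<^sup>2)"
      using Q by (simp add: R_def vec_norm2_sq c_def r_def)
    then show ?thesis
      unfolding sum_cmod_sq_orthogonal[OF qc] by (simp add: q2 C_def)
  qed
  define A where "A l i j = a l * s * q i * q j + b l * c i * q j + g l * q i * c j" for l i j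
  obtain D where D: "D \<in> matpolys k N"
    and DA: "\<And>l. l \<le> k \<Longrightarrow> mp_coeff D l = mat N N (\<lambda>(i, j). A l i j)"
    using matpoly_of_coeffs[of k N A] by blast
  \<comment> \<open>The part with \<open>g\<close> annihilates \<open>u\<close>, so \<open>g\<close>
    does not affect the residual and is free for imposing symmetry.\<close>
  have Au: "(mp_coeff D l *\<^sub>v u) $ i = a l * s * q i + b l * c i" if "l \<le> k" "i < N" for l i
  proof -
    have "(mp_coeff D l *\<^sub>v u) $ i = (\<Sum>j<N. A l i j * u $ j)"
      using that u by (auto simp: DA scalar_prod_def lessThan_atLeast0 intro!: sum.cong)
    also have "\<dots> = (a l * s * q i + b l * c i) * (\<Sum>j<N. q j * u $ j)
        + g l * q i * (\<Sum>j<N. c j * u $ j)"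
      by (simp add: A_def sum_distrib_left sum.distrib[symmetric] algebra_simps)
    finally show ?thesis
      by (simp add: qu cu)
  qed
  have eval: "(mp_eval D z *\<^sub>v u) $ i = r i" if "i < N" for i
  proof -
    have "(mp_eval D z *\<^sub>v u) $ i = (\<Sum>l\<le>k. z ^ l * (a l * s * q i + b l * c i))"
      unfolding mp_eval_mult_vec_index[OF D u(1) that] using that
      by (intro sum.cong) (simp_all add: Au del: index_mult_mat_vec(1))
    also have "\<dots> = (\<Sum>l\<le>k. z ^ l * a l) * (s * q i) + (\<Sum>l\<le>k. z ^ l * b l) * c i"
      by (simp add: sum_distrib_left sum.distrib[symmetric] algebra_simps)
    finally show ?thesis
      by (simp add: a b c_def)
  qed
  have frob: "(frobenius_norm (mp_coeff D l))\<^sup>2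
      = ((cmod (a l))\<^sup>2 * ((cmod s)\<^sup>2 / \<omega>) + ((cmod (b l))\<^sup>2 + (cmod (g l))\<^sup>2) * C) / \<omega>"
    if "l \<le> k" for l
  proof -
    have "(frobenius_norm (mp_coeff D l))\<^sup>2 = (\<Sum>i<N. \<Sum>j<N. (cmod (A l i j))\<^sup>2)"
      using that by (simp add: frobenius_norm_def sum_nonneg DA del: dim_mp_coeff)
    \<comment> \<open>Each row is a combination of the orthogonal vectors \<open>q\<close> and
      \<open>c\<close>: Pythagoras is applied first along the rows, then once more along the columns
      to the factor of \<open>q j\<close>.\<close>
    also have "\<dots> = (\<Sum>i<N. (\<Sum>j<N. (cmod ((a l * s * q i + b l * c i) * q j + (g l * q i) * c j))\<^sup>2))"
      by (simp add: A_def algebra_simps)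
    also have "\<dots> = (\<Sum>i<N. (cmod ((a l * s) * q i + b l * c i))\<^sup>2 * (1 / \<omega>)
        + (cmod (g l))\<^sup>2 * (cmod (q i))\<^sup>2 * C)"
      unfolding sum_cmod_sq_orthogonal[OF qc] q2 C_def[symmetric]
      by (simp add: norm_mult power_mult_distrib)
    also have "\<dots> = (\<Sum>i<N. (cmod ((a l * s) * q i + b l * c i))\<^sup>2) * (1 / \<omega>)
        + (cmod (g l))\<^sup>2 * (\<Sum>i<N. (cmod (q i))\<^sup>2) * C"
      by (simp only: sum.distrib sum_distrib_left sum_distrib_right)
    also have "\<dots> = ((cmod (a l))\<^sup>2 * ((cmod s)\<^sup>2 / \<omega>) + ((cmod (b l))\<^sup>2 + (cmod (g l))\<^sup>2) * C) / \<omega>"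
      unfolding sum_cmod_sq_orthogonal[OF qc] q2 C_def[symmetric]
      by (simp add: norm_mult power_mult_distrib add_divide_distrib algebra_simps)
    finally show ?thesis .
  qed
  have "(mp_norm M k D)\<^sup>2 \<le> (\<Sum>l\<le>k. (frobenius_norm (mp_coeff D l))\<^sup>2)"
    by (auto simp: mp_norm_def sum_nonneg intro!: sum_mono power_mono matrix_norm_bounds[OF M])
  also have "\<dots> = ((\<Sum>l\<le>k. (cmod (a l))\<^sup>2) * ((cmod s)\<^sup>2 / \<omega>)
      + (\<Sum>l\<le>k. (cmod (b l))\<^sup>2 + (cmod (g l))\<^sup>2) * C) / \<omega>"
    by (simp add: frob sum_distrib_right sum_divide_distrib flip: sum.distrib)
  \<comment> \<open>With the common bound \<open>K\<close> the two parts recombine to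
    \<open>R\<^sup>2\<close>.\<close>
  also have "\<dots> \<le> (K * ((cmod s)\<^sup>2 / \<omega>) + K * C) / \<omega>"
    using \<omega> C by (intro divide_right_mono add_mono mult_right_mono Ka Kb) auto
  also have "\<dots> = (sqrt K * R / vec_norm2 u)\<^sup>2"
  proof -
    have "0 \<le> (\<Sum>l\<le>k. (cmod (a l))\<^sup>2)"
      by (simp add: sum_nonneg)
    then have "0 \<le> K"
      using Ka by linarith
    then show ?thesis
      by (simp add: power_divide power_mult_distrib R \<omega>_def[symmetric] distrib_left)
  qed
  finally have norm: "mp_norm M k D \<le> sqrt K * R / vec_norm2 u"
  proof (rule power2_le_imp_le)
    have "0 \<le> (\<Sum>l\<le>k. (cmod (a l))\<^sup>2)"
      by (simp add: sum_nonneg)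
    then show "0 \<le> sqrt K * R / vec_norm2 u"
      using Ka by (simp add: R_def)
  qed
  show thesis
  proof
    show "mp_eval Q z *\<^sub>v u + mp_eval D z *\<^sub>v u = 0\<^sub>v N"
      using D Q eval by (intro eq_vecI) (auto simp: matpolys_def r_def simp del: index_mult_mat_vec(1))
    \<comment> \<open>Transposition fixes \<open>q q\<^sup>T\<close> and exchanges
      \<open>c q\<^sup>T\<close> with \<open>q c\<^sup>T\<close>, hence the conditions linking
      \<open>b\<close> and \<open>g\<close>.\<close>
    show "transpose_mat (mp_coeff D l) = e \<cdot>\<^sub>m mp_coeff D l"
      if "l \<le> k" "a l = e * a l" "g l = e * b l" "b l = e * g l" for e l
    proof (rule eq_matI)
      fix i j assume "i < dim_row (e \<cdot>\<^sub>m mp_coeff D l)" "j < dim_col (e \<cdot>\<^sub>m mp_coeff D l)"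
      then have "i < N" "j < N"
        using D by (auto simp: matpolys_def)
      moreover have "A l j i = e * A l i j"
      proof -
        have "e * A l i j = (e * a l) * s * q i * q j + (e * b l) * c i * q j + (e * g l) * q i * c j"
          by (simp add: A_def algebra_simps)
        also have "\<dots> = A l j i"
          unfolding that(2-4)[symmetric] by (simp add: A_def algebra_simps)
        finally show ?thesis ..
      qed
      ultimately show "transpose_mat (mp_coeff D l) $$ (i, j) = (e \<cdot>\<^sub>m mp_coeff D l) $$ (i, j)"
        using \<open>l \<le> k\<close> by (simp add: DA del: dim_mp_coeff)
    qed (use D in \<open>auto simp: matpolys_def\<close>)
  qed (use D norm R_def in auto)
qed

section \<open>From symmetric and skew coefficients to \<open>T\<close>-structured pencils\<close>

text \<open>The coefficients are alternately symmetric and skew; \<open>e = 1\<close> gives the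
  \<open>T\<close>-even and \<open>e = - 1\<close> the \<open>T\<close>-odd case.\<close>

lemma transpose_mp_eval:
  assumes D: "D \<in> matpolys k N"
    and sym: "\<And>l. l \<le> k \<Longrightarrow> transpose_mat (mp_coeff D l) = (e * (- 1) ^ l) \<cdot>\<^sub>m mp_coeff D l"
  shows "transpose_mat (mp_eval D z) = e \<cdot>\<^sub>m mp_eval D (- z)"
proof (rule eq_matI)
  have dim: "dim_row D = N" "dim_col D = N"
    using D by (auto simp: matpolys_def)
  fix i j assume "i < dim_row (e \<cdot>\<^sub>m mp_eval D (- z))" "j < dim_col (e \<cdot>\<^sub>m mp_eval D (- z))"
  then have ij: "i < N" "j < N"
    using dim by auto
  have coeff: "mp_coeff D l $$ (j, i) = e * (- 1) ^ l * mp_coeff D l $$ (i, j)" if "l \<le> k" for l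
    using arg_cong[OF sym[OF that], of "\<lambda>A. A $$ (i, j)"] ij dim by simp
  have "mp_eval D z $$ (j, i) = (\<Sum>l\<le>k. z ^ l * mp_coeff D l $$ (j, i))"
    by (rule mp_eval_eq_sum[OF D ij(2,1)])
  also have "\<dots> = (\<Sum>l\<le>k. e * ((- z) ^ l * mp_coeff D l $$ (i, j)))"
    by (intro sum.cong) (simp_all add: coeff power_minus[of z])
  also have "\<dots> = e * mp_eval D (- z) $$ (i, j)"
    by (simp add: mp_eval_eq_sum[OF D ij] sum_distrib_left)
  finally show "transpose_mat (mp_eval D z) $$ (i, j) = (e \<cdot>\<^sub>m mp_eval D (- z)) $$ (i, j)"
    using ij dim by simp
qed (use D in \<open>auto simp: matpolys_def\<close>)

lemma one_plus_cmod_sq_neq_0: "1 + complex_of_real ((cmod z)\<^sup>2) \<noteq> 0"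
proof -
  have "complex_of_real (1 + (cmod z)\<^sup>2) \<noteq> 0"
    unfolding of_real_eq_0_iff using zero_le_power2[of "cmod z"] by linarith
  then show ?thesis
    by simp
qed

text \<open>The general lower bound is attained: weights proportional to \<open>cnj z ^ l\<close>
  give equality in Cauchy-Schwarz, and with \<open>g = 0\<close> the perturbation has exactly the
  norm of the bound.\<close>

lemma backward_error_eq:
  assumes M: "M \<in> {spectral_norm, frobenius_norm}"
    and Q: "Q \<in> carrier_mat N N" and u: "u \<in> carrier_vec N" "u \<noteq> 0\<^sub>v N"
  shows "backward_error M k z u Q
    = vec_norm2 (mp_eval Q z *\<^sub>v u) / (vec_norm2 u * vec_norm2 (Lambda_vec k z))"
proof -
  define p where "p = (vec_norm2 (Lambda_vec k z))\<^sup>2"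
  have p: "0 < p" "p = (\<Sum>l\<le>k. (cmod z ^ l)\<^sup>2)"
    using vec_norm2_Lambda_vec_pos[of k z]
    by (simp add: p_def) (simp add: p_def vec_norm2_Lambda_vec_sq mult.commute flip: power_mult)
  define a where "a l = cnj z ^ l / of_real p" for l
  have a: "(\<Sum>l\<le>k. z ^ l * a l) = 1"
  proof -
    have "(\<Sum>l\<le>k. z ^ l * cnj z ^ l) = of_real p"
      unfolding p(2) of_real_sum
    proof (rule sum.cong[OF refl])
      show "z ^ l * cnj z ^ l = of_real ((cmod z ^ l)\<^sup>2)" for l
        using complex_norm_square[of "z ^ l"] by (simp add: norm_power)
    qed
    then show ?thesis
      using p(1) by (simp add: a_def flip: sum_divide_distrib)
  qed
  have "(\<Sum>l\<le>k. (cmod (a l))\<^sup>2) = p / p\<^sup>2"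
    using p(1) by (simp add: a_def norm_divide norm_power power_divide p(2)[symmetric]
        flip: sum_divide_distrib)
  then have K: "(\<Sum>l\<le>k. (cmod (a l))\<^sup>2) \<le> 1 / p" "(\<Sum>l\<le>k. (cmod (a l))\<^sup>2 + (cmod 0)\<^sup>2) \<le> 1 / p"
    using p(1) by (auto simp: power2_eq_square)
  obtain D where D: "D \<in> matpolys k N" "mp_eval Q z *\<^sub>v u + mp_eval D z *\<^sub>v u = 0\<^sub>v N"
    and norm: "mp_norm M k D \<le> sqrt (1 / p) * vec_norm2 (mp_eval Q z *\<^sub>v u) / vec_norm2 u"
    using backward_perturbation[OF M Q u a a K] by metis
  have "backward_error M k z u Q \<le> mp_norm M k D"
    unfolding backward_error_def using D u by (intro structured_backward_error_le) auto
  also have "\<dots> \<le> vec_norm2 (mp_eval Q z *\<^sub>v u) / (vec_norm2 u * vec_norm2 (Lambda_vec k z))"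
    using norm by (simp add: p_def real_sqrt_divide mult.commute)
  finally show ?thesis
    using structured_backward_error_ge[OF M order_refl Q u D] u
    by (simp add: backward_error_def)
qed

text \<open>The constant coefficient has to be symmetric and the leading one skew.\<close>

lemma T_even_pencil_perturbation:
  assumes M: "M \<in> {spectral_norm, frobenius_norm}"
    and Q: "Q \<in> carrier_mat N N" and u: "u \<in> carrier_vec N" "u \<noteq> 0\<^sub>v N" and z: "cmod z \<le> 1"
  obtains D where "D \<in> T_even_matpolys 1 N" "mp_eval Q z *\<^sub>v u + mp_eval D z *\<^sub>v u = 0\<^sub>v N"
    "mp_norm M 1 D \<le> sqrt (2 / (1 + (cmod z)\<^sup>2)) * vec_norm2 (mp_eval Q z *\<^sub>v u) / vec_norm2 u"
proof -
  define t where "t = (cmod z)\<^sup>2"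
  have t: "0 \<le> t" "t \<le> 1"
    using z by (auto simp: t_def power_le_one)
  have t1: "complex_of_real t = z * cnj z" "1 + complex_of_real t \<noteq> 0"
    using one_plus_cmod_sq_neq_0[of z] by (auto simp: t_def complex_norm_square simp del: of_real_power)
  have n1: "cmod (1 + complex_of_real t) = 1 + t"
    using t by (metis norm_of_real of_real_1 of_real_add abs_of_nonneg add_nonneg_nonneg zero_le_one)
  \<comment> \<open>A skew matrix has zero quadratic form at \<open>u\<close>, so the part along
    \<open>q\<close> is left entirely to the constant coefficient.\<close>
  define a where "a l = (if l = 0 then 1 else 0 :: complex)" for l :: nat
  \<comment> \<open>The solution of \<open>b 0 + z * b 1 = 1\<close> of least Euclidean norm, its
    squared norm being \<open>1 / (1 + t)\<close>.\<close>
  define b where "b l = cnj z ^ l / (1 + of_real t)" for l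
  \<comment> \<open>The sign makes the parts with \<open>b\<close> and \<open>g\<close> together
    symmetric for \<open>l = 0\<close> and skew for \<open>l = 1\<close>.\<close>
  define g where "g l = (- 1) ^ l * b l" for l
  have a: "(\<Sum>l\<le>1. z ^ l * a l) = 1"
    by (simp add: a_def)
  have b: "(\<Sum>l\<le>1. z ^ l * b l) = 1"
    using t1 by (simp add: b_def t1(1) flip: add_divide_distrib)
  have Ka: "(\<Sum>l\<le>1. (cmod (a l))\<^sup>2) \<le> 2 / (1 + t)"
    using t by (simp add: a_def)
  \<comment> \<open>The mirrored part with \<open>g\<close> doubles the cost of \<open>b\<close>;
    this is the source of the factor 2.\<close>
  have Kb: "(\<Sum>l\<le>1. (cmod (b l))\<^sup>2 + (cmod (g l))\<^sup>2) \<le> 2 / (1 + t)"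
  proof -
    have "(\<Sum>l\<le>1. (cmod (b l))\<^sup>2 + (cmod (g l))\<^sup>2) = (2 + 2 * t) / (1 + t)\<^sup>2"
      by (simp add: b_def g_def norm_divide norm_mult n1 power_divide t_def[symmetric] add_divide_distrib)
    also have "\<dots> = 2 / (1 + t)"
      using t by (simp add: power2_eq_square divide_simps)
    finally show ?thesis by simp
  qed
  obtain D where D: "D \<in> matpolys 1 N" "mp_eval Q z *\<^sub>v u + mp_eval D z *\<^sub>v u = 0\<^sub>v N"
    "mp_norm M 1 D \<le> sqrt (2 / (1 + t)) * vec_norm2 (mp_eval Q z *\<^sub>v u) / vec_norm2 u"
    and sym: "\<And>e l. \<lbrakk>l \<le> 1; a l = e * a l; g l = e * b l; b l = e * g l\<rbrakk>
      \<Longrightarrow> transpose_mat (mp_coeff D l) = e \<cdot>\<^sub>m mp_coeff D l"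
    using backward_perturbation[OF M Q u a b Ka Kb] by metis
  have "transpose_mat (mp_coeff D l) = (1 * (- 1) ^ l) \<cdot>\<^sub>m mp_coeff D l" if "l \<le> 1" for l
    using that by (intro sym) (auto simp: a_def g_def)
  from transpose_mp_eval[OF D(1) this] have "D \<in> T_even_matpolys 1 N"
    using D(1) by (auto simp: T_even_matpolys_def intro!: eq_matI)
  with D that show thesis
    by (simp add: t_def)
qed

text \<open>Now the constant coefficient is skew and the leading one symmetric, so the part along
  \<open>q\<close> moves to the leading coefficient.\<close>

lemma T_odd_pencil_perturbation:
  assumes M: "M \<in> {spectral_norm, frobenius_norm}"
    and Q: "Q \<in> carrier_mat N N" and u: "u \<in> carrier_vec N" "u \<noteq> 0\<^sub>v N" and z: "cmod z \<ge> 1"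
  obtains D where "D \<in> T_odd_matpolys 1 N" "mp_eval Q z *\<^sub>v u + mp_eval D z *\<^sub>v u = 0\<^sub>v N"
    "mp_norm M 1 D \<le> sqrt (2 / (1 + (cmod z)\<^sup>2)) * vec_norm2 (mp_eval Q z *\<^sub>v u) / vec_norm2 u"
proof -
  define t where "t = (cmod z)\<^sup>2"
  have t: "1 \<le> t"
    using z by (simp add: t_def)
  have t1: "complex_of_real t = z * cnj z" "1 + complex_of_real t \<noteq> 0"
    using one_plus_cmod_sq_neq_0[of z] by (auto simp: t_def complex_norm_square simp del: of_real_power)
  have n1: "cmod (1 + complex_of_real t) = 1 + t"
    using t by (metis norm_of_real of_real_1 of_real_add abs_of_nonneg add_nonneg_nonneg zero_le_one order_trans)
  \<comment> \<open>The leading coefficient is multiplied by \<open>z\<close>, which is nonzero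
    here, so it must carry the weight \<open>1 / z\<close>, at squared cost
    \<open>1 / t\<close>.\<close>
  define a where "a l = (if l = 0 then 0 else 1 / z)" for l :: nat
  define b where "b l = cnj z ^ l / (1 + of_real t)" for l
  define g where "g l = - ((- 1) ^ l * b l)" for l
  have a: "(\<Sum>l\<le>1. z ^ l * a l) = 1"
    using z by (auto simp: a_def)
  have b: "(\<Sum>l\<le>1. z ^ l * b l) = 1"
    using t1 by (simp add: b_def t1(1) flip: add_divide_distrib)
  have Ka: "(\<Sum>l\<le>1. (cmod (a l))\<^sup>2) \<le> 2 / (1 + t)"
    using t by (simp add: a_def norm_divide power_divide t_def[symmetric] divide_simps)
  have Kb: "(\<Sum>l\<le>1. (cmod (b l))\<^sup>2 + (cmod (g l))\<^sup>2) \<le> 2 / (1 + t)"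
  proof -
    have "(\<Sum>l\<le>1. (cmod (b l))\<^sup>2 + (cmod (g l))\<^sup>2) = (2 + 2 * t) / (1 + t)\<^sup>2"
      by (simp add: b_def g_def norm_divide norm_mult n1 power_divide t_def[symmetric] add_divide_distrib)
    also have "\<dots> = 2 / (1 + t)"
      using t by (simp add: power2_eq_square divide_simps)
    finally show ?thesis by simp
  qed
  obtain D where D: "D \<in> matpolys 1 N" "mp_eval Q z *\<^sub>v u + mp_eval D z *\<^sub>v u = 0\<^sub>v N"
    "mp_norm M 1 D \<le> sqrt (2 / (1 + t)) * vec_norm2 (mp_eval Q z *\<^sub>v u) / vec_norm2 u"
    and sym: "\<And>e l. \<lbrakk>l \<le> 1; a l = e * a l; g l = e * b l; b l = e * g l\<rbrakk>
      \<Longrightarrow> transpose_mat (mp_coeff D l) = e \<cdot>\<^sub>m mp_coeff D l"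
    using backward_perturbation[OF M Q u a b Ka Kb] by metis
  have "transpose_mat (mp_coeff D l) = (- 1 * (- 1) ^ l) \<cdot>\<^sub>m mp_coeff D l" if "l \<le> 1" for l
    using that by (intro sym) (auto simp: a_def g_def le_Suc_eq)
  from transpose_mp_eval[OF D(1) this] have "transpose_mat (mp_eval D w) = - mp_eval D (- w)" for w
    by (auto intro!: eq_matI)
  then have "D \<in> T_odd_matpolys 1 N"
    using D(1) by (simp add: T_odd_matpolys_def)
  with D that show thesis
    by (simp add: t_def)
qed

section \<open>Ansatz pencils\<close>

text \<open>The index range is cut into \<open>m\<close> blocks of length \<open>n\<close>;
  \<open>i div n\<close> is the block and \<open>i mod n\<close> the position inside it.\<close>

lemma sum_div_mod:
  fixes f g :: "nat \<Rightarrow> 'a :: semiring_0" and m n :: nat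
  shows "(\<Sum>i<m * n. f (i div n) * g (i mod n)) = (\<Sum>i<m. f i) * (\<Sum>j<n. g j)"
proof -
  have "(\<Sum>i<m * n. f (i div n) * g (i mod n))
      = (\<Sum>i<m. \<Sum>j = i * n..<i * n + n. f (j div n) * g (j mod n))"
    by (rule sum.nat_group[symmetric])
  also have "\<dots> = (\<Sum>i<m. \<Sum>j<n. f i * g j)"
  proof (rule sum.cong[OF refl])
    fix i
    have "(\<Sum>j = i * n..<i * n + n. f (j div n) * g (j mod n))
        = (\<Sum>j<n. f ((j + i * n) div n) * g ((j + i * n) mod n))"
      using sum.shift_bounds_nat_ivl[of "\<lambda>j. f (j div n) * g (j mod n)" 0 "i * n" n]
      by (simp add: lessThan_atLeast0 add.commute)
    also have "\<dots> = (\<Sum>j<n. f i * g j)"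
      by (intro sum.cong) auto
    finally show "(\<Sum>j = i * n..<i * n + n. f (j div n) * g (j mod n)) = (\<Sum>j<n. f i * g j)" .
  qed
  finally show ?thesis
    by (simp add: sum_product)
qed

lemma dim_kron_vec [simp]: "dim_vec (kron_vec u w) = dim_vec u * dim_vec w"
  by (simp add: kron_vec_def)

lemma vec_norm2_kron_vec: "vec_norm2 (kron_vec u w) = vec_norm2 u * vec_norm2 w"
proof (rule power2_eq_imp_eq)
  have "(vec_norm2 (kron_vec u w))\<^sup>2 = (\<Sum>i<dim_vec u * dim_vec w.
      (cmod (u $ (i div dim_vec w)))\<^sup>2 * (cmod (w $ (i mod dim_vec w)))\<^sup>2)"
    unfolding vec_norm2_sq by (simp add: kron_vec_def norm_mult power_mult_distrib)
  then show "(vec_norm2 (kron_vec u w))\<^sup>2 = (vec_norm2 u * vec_norm2 w)\<^sup>2"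
    by (simp add: sum_div_mod[where f = "\<lambda>i. (cmod (u $ i))\<^sup>2" and g = "\<lambda>i. (cmod (w $ i))\<^sup>2"]
        vec_norm2_sq power_mult_distrib)
qed simp_all

lemma kron_mat_col_mat_mult_vec:
  fixes u x :: "'a :: comm_ring_1 vec"
  assumes "x \<in> carrier_vec (dim_col A)"
  shows "kron_mat (col_mat u) A *\<^sub>v x = kron_vec u (A *\<^sub>v x)"
proof (rule eq_vecI)
  fix i assume "i < dim_vec (kron_vec u (A *\<^sub>v x))"
  then have i: "i < dim_vec u * dim_row A"
    by simp
  then have i': "i div dim_row A < dim_vec u" "i mod dim_row A < dim_row A"
    by (auto simp: less_mult_imp_div_less intro!: mod_less_divisor gr0I)
  have "(kron_mat (col_mat u) A *\<^sub>v x) $ i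
      = (\<Sum>j<dim_col A. u $ (i div dim_row A) * (A $$ (i mod dim_row A, j) * x $ j))"
    using assms i i' by (auto simp: kron_mat_def col_mat_def mat_of_cols_def scalar_prod_def
        lessThan_atLeast0 mult.assoc intro!: sum.cong)
  also have "\<dots> = kron_vec u (A *\<^sub>v x) $ i"
    using assms i i' by (auto simp: kron_vec_def scalar_prod_def lessThan_atLeast0 sum_distrib_left
        intro!: sum.cong)
  finally show "(kron_mat (col_mat u) A *\<^sub>v x) $ i = kron_vec u (A *\<^sub>v x) $ i" .
qed (auto simp: kron_mat_def col_mat_def)

text \<open>The Kronecker product of \<open>\<Lambda>\<close> and \<open>x\<close> is that of
  \<open>\<Lambda>\<close> and the identity applied to \<open>x\<close>, so the ansatz equation can
  be used under the product with \<open>x\<close>.\<close>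

lemma right_ansatz_mult_kron_vec:
  assumes L: "L \<in> carrier_mat (m * n) (m * n)" and P: "P \<in> carrier_mat n n"
    and ansatz: "right_ansatz_vector m n P L v" and x: "x \<in> carrier_vec n" and "1 \<le> m"
  shows "mp_eval L z *\<^sub>v kron_vec (Lambda_vec (m - 1) z) x = kron_vec v (mp_eval P z *\<^sub>v x)"
proof -
  let ?K = "kron_mat (col_mat (Lambda_vec (m - 1) z)) (1\<^sub>m n)"
  have K: "?K \<in> carrier_mat (m * n) n"
    using \<open>1 \<le> m\<close> by (simp add: kron_mat_def col_mat_def Lambda_vec_def)
  have "mp_eval L z *\<^sub>v kron_vec (Lambda_vec (m - 1) z) x = mp_eval L z *\<^sub>v (?K *\<^sub>v x)"
    using x by (simp add: kron_mat_col_mat_mult_vec)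
  also have "\<dots> = (mp_eval L z * ?K) *\<^sub>v x"
    using L K x by (intro assoc_mult_mat_vec[symmetric, of _ "m * n" "m * n" _ n]) (auto simp: mp_eval_def)
  also have "\<dots> = kron_vec v (mp_eval P z *\<^sub>v x)"
    using ansatz P x by (simp add: right_ansatz_vector_def kron_mat_col_mat_mult_vec)
  finally show ?thesis .
qed

section \<open>Quotients of geometric sums\<close>

lemma geometric_sum_ratio_bounds:
  fixes t :: real
  assumes "0 \<le> t" "1 \<le> m"
  shows "(real m + 1) / (2 * real m) \<le> (\<Sum>l\<le>m. t ^ l) / ((1 + t) * (\<Sum>l\<le>m - 1. t ^ l))"
    and "(\<Sum>l\<le>m. t ^ l) / ((1 + t) * (\<Sum>l\<le>m - 1. t ^ l)) \<le> 1"
proof -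
  define p where "p = (\<Sum>l\<le>m. t ^ l)"
  define p' where "p' = (\<Sum>l\<le>m - 1. t ^ l)"
  have p: "p = p' + t ^ m" "p = 1 + t * p'"
    using assms(2) sum.atMost_Suc[of "\<lambda>l. t ^ l" "m - 1"]
      sum.atMost_Suc_shift[of "\<lambda>l. t ^ l" "m - 1"]
    by (simp_all add: p_def p'_def sum_distrib_left)
  have one_le_p': "1 \<le> p'"
    unfolding p'_def using assms member_le_sum[of 0 "{..m - 1}" "\<lambda>l. t ^ l"] by simp
  then have p': "0 < p'"
    by simp
  have pos: "0 < (1 + t) * p'"
    using assms p' by simp
  have "2 * p = (\<Sum>l\<le>m. t ^ l + t ^ (m - l))"
    unfolding sum.distrib p_def using sum.nat_diff_reindex[of "\<lambda>l. t ^ l" "Suc m"]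
    by (simp add: lessThan_Suc_atMost)
  also have "\<dots> \<le> (\<Sum>l\<le>m. 1 + t ^ m)"
  proof (rule sum_mono)
    fix l assume "l \<in> {..m}"
    then have "t ^ m = t ^ l * t ^ (m - l)"
      by (simp flip: power_add)
    \<comment> \<open>Both factors have the same sign, since all powers of \<open>t\<close> lie on
      the same side of 1.\<close>
    moreover have "0 \<le> (1 - t ^ l) * (1 - t ^ (m - l))"
    proof (cases "t \<le> 1")
      case True
      then show ?thesis
        using assms by (intro mult_nonneg_nonneg) (auto simp: power_le_one)
    next
      case False
      then show ?thesis
        by (intro mult_nonpos_nonpos) auto
    qed
    ultimately show "t ^ l + t ^ (m - l) \<le> 1 + t ^ m"
      by (simp add: algebra_simps)
  qed
  also have "\<dots> = (real m + 1) * (1 + t ^ m)"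
    by simp
  finally have "2 * p \<le> (real m + 1) * (1 + t ^ m)" .
  \<comment> \<open>Adds the two recursions \<open>p' = p - t ^ m\<close> and
    \<open>t * p' = p - 1\<close>.\<close>
  moreover have sum: "(1 + t) * p' = 2 * p - (1 + t ^ m)"
    using p by (simp add: algebra_simps)
  ultimately have "(real m + 1) * ((1 + t) * p') \<le> 2 * real m * p"
    unfolding sum right_diff_distrib by (simp add: algebra_simps)
  then have "(real m + 1) / (2 * real m) \<le> p / ((1 + t) * p')"
    using pos assms(2) by (simp add: divide_simps mult.commute split: if_splits)
  then show "(real m + 1) / (2 * real m) \<le> (\<Sum>l\<le>m. t ^ l) / ((1 + t) * (\<Sum>l\<le>m - 1. t ^ l))"
    by (simp add: p_def p'_def)
  \<comment> \<open>The constant term in \<open>p = 1 + t * p'\<close> is at most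
    \<open>p'\<close>.\<close>
  have "p \<le> (1 + t) * p'"
    using p(2) one_le_p' by (simp add: algebra_simps)
  then show "(\<Sum>l\<le>m. t ^ l) / ((1 + t) * (\<Sum>l\<le>m - 1. t ^ l)) \<le> 1"
    using pos by (simp add: p_def p'_def)
qed

section \<open>Comparison of the two backward errors\<close>

text \<open>Treats both parities together: the structure enters only through \<open>pert\<close>,
  the existence of a perturbation within the factor \<open>sqrt 2\<close> of the general lower
  bound.\<close>

lemma backward_error_ratio_bounds:
  assumes M: "M \<in> {spectral_norm, frobenius_norm}" and m: "1 \<le> m"
    and P: "P \<in> carrier_mat n n" and x: "x \<in> carrier_vec n" "vec_norm2 x = 1"
    and Px: "mp_eval P z *\<^sub>v x \<noteq> 0\<^sub>v n"
    and L: "L \<in> carrier_mat (m * n) (m * n)"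
    and v: "right_ansatz_vector m n P L v" "vec_norm2 v = 1"
    and S: "S \<subseteq> matpolys 1 (m * n)"
    and pert: "\<And>u. \<lbrakk>u \<in> carrier_vec (m * n); u \<noteq> 0\<^sub>v (m * n)\<rbrakk> \<Longrightarrow>
      \<exists>D\<in>S. mp_eval L z *\<^sub>v u + mp_eval D z *\<^sub>v u = 0\<^sub>v (m * n) \<and>
        mp_norm M 1 D \<le> sqrt (2 / (1 + (cmod z)\<^sup>2)) * vec_norm2 (mp_eval L z *\<^sub>v u) / vec_norm2 u"
  defines "\<eta>\<^sub>L \<equiv> structured_backward_error M S 1 z (kron_vec (Lambda_vec (m - 1) z) x) L"
    and "\<eta>\<^sub>P \<equiv> backward_error M m z x P"
  shows "sqrt ((real m + 1) / (2 * real m)) \<le> \<eta>\<^sub>L / \<eta>\<^sub>P" and "\<eta>\<^sub>L / \<eta>\<^sub>P \<le> sqrt 2"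
proof -
  define t where "t = (cmod z)\<^sup>2"
  define u where "u = kron_vec (Lambda_vec (m - 1) z) x"
  define \<Lambda>' where "\<Lambda>' = vec_norm2 (Lambda_vec (m - 1) z)"
  define \<Lambda> where "\<Lambda> = vec_norm2 (Lambda_vec m z)"
  define R where "R = vec_norm2 (mp_eval P z *\<^sub>v x)"
  \<comment> \<open>The unstructured lower bound for the pencil divided by the backward error of
    \<open>P\<close>; the residual norm \<open>R\<close> cancels.\<close>
  define \<rho> where "\<rho> = \<Lambda> / (\<Lambda>' * sqrt (1 + t))"
  have t: "0 \<le> t"
    by (simp add: t_def)
  have \<Lambda>: "0 < \<Lambda>" "0 < \<Lambda>'"
    by (simp_all add: \<Lambda>_def \<Lambda>'_def vec_norm2_Lambda_vec_pos)
  have R: "0 < R"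
    unfolding R_def using P Px by (intro vec_norm2_pos[of _ n]) (auto intro: carrier_vecI)
  have u_norm: "vec_norm2 u = \<Lambda>'"
    by (simp add: u_def vec_norm2_kron_vec \<Lambda>'_def x)
  have u: "u \<in> carrier_vec (m * n)" "u \<noteq> 0\<^sub>v (m * n)"
    using u_norm \<Lambda>(2) m x by (auto simp: u_def Lambda_vec_def intro!: carrier_vecI)
  \<comment> \<open>The ansatz equation turns the pencil residual into a Kronecker product with
    \<open>v\<close>, and \<open>v\<close> has norm 1.\<close>
  have Lu: "vec_norm2 (mp_eval L z *\<^sub>v u) = R"
    unfolding u_def right_ansatz_mult_kron_vec[OF L P v(1) x(1) m]
    by (simp add: vec_norm2_kron_vec v R_def)
  have x0: "x \<noteq> 0\<^sub>v n"
    using x by auto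
  have \<eta>L: "\<eta>\<^sub>L = structured_backward_error M S 1 z u L"
    by (simp add: \<eta>\<^sub>L_def u_def)
  have \<eta>P: "\<eta>\<^sub>P = R / \<Lambda>"
    unfolding \<eta>\<^sub>P_def backward_error_eq[OF M P x(1) x0] by (simp add: R_def \<Lambda>_def x)
  have \<Lambda>1: "vec_norm2 (Lambda_vec 1 z) = sqrt (1 + t)"
    by (rule power2_eq_imp_eq) (use t in \<open>auto simp: vec_norm2_Lambda_vec_sq t_def\<close>)
  obtain D where D: "D \<in> S" "mp_eval L z *\<^sub>v u + mp_eval D z *\<^sub>v u = 0\<^sub>v (m * n)"
    and D_norm: "mp_norm M 1 D \<le> sqrt (2 / (1 + t)) * R / \<Lambda>'"
    using pert[OF u] Lu u_norm t_def by auto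
  have "R / (\<Lambda>' * sqrt (1 + t)) \<le> \<eta>\<^sub>L"
    using structured_backward_error_ge[OF M S L u D]
    by (simp add: \<eta>L Lu u_norm \<Lambda>1[unfolded One_nat_def])
  then have "(R / (\<Lambda>' * sqrt (1 + t))) / \<eta>\<^sub>P \<le> \<eta>\<^sub>L / \<eta>\<^sub>P"
    using R \<Lambda> by (intro divide_right_mono) (auto simp: \<eta>P)
  then have lower: "\<rho> \<le> \<eta>\<^sub>L / \<eta>\<^sub>P"
    using R by (simp add: \<eta>P \<rho>_def)
  have "\<eta>\<^sub>L \<le> sqrt (2 / (1 + t)) * R / \<Lambda>'"
    using structured_backward_error_le[of D S L z u M 1] D D_norm u
    by (simp add: \<eta>L)
  then have "\<eta>\<^sub>L / \<eta>\<^sub>P \<le> (sqrt (2 / (1 + t)) * R / \<Lambda>') / \<eta>\<^sub>P"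
    using R \<Lambda> by (intro divide_right_mono) (auto simp: \<eta>P)
  also have "\<dots> = sqrt 2 * \<rho>"
    using R by (simp add: \<eta>P \<rho>_def real_sqrt_divide mult.commute)
  finally have upper: "\<eta>\<^sub>L / \<eta>\<^sub>P \<le> sqrt 2 * \<rho>" .
  have \<rho>: "\<rho> = sqrt ((\<Sum>l\<le>m. t ^ l) / ((1 + t) * (\<Sum>l\<le>m - 1. t ^ l)))"
    unfolding t_def vec_norm2_Lambda_vec_sq[symmetric]
    by (simp add: \<rho>_def \<Lambda>_def \<Lambda>'_def t_def real_sqrt_divide real_sqrt_mult mult.commute)
  note bounds = geometric_sum_ratio_bounds[OF t m]
  show "sqrt ((real m + 1) / (2 * real m)) \<le> \<eta>\<^sub>L / \<eta>\<^sub>P"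
    using real_sqrt_le_mono[OF bounds(1)] lower unfolding \<rho> by (rule order_trans)
  have "\<rho> \<le> 1"
    unfolding \<rho> using bounds(2) by simp
  then have "sqrt 2 * \<rho> \<le> sqrt 2"
    by simp
  with upper show "\<eta>\<^sub>L / \<eta>\<^sub>P \<le> sqrt 2"
    by (rule order_trans)
qed

theorem theorem4p5:
  fixes m n :: nat and P :: "complex poly mat" and lam :: complex and x :: "complex vec"
    and M :: "complex mat \<Rightarrow> real"
  assumes "m \<ge> 1" and "n \<ge> 1"
    and "P \<in> T_even_matpolys m n" and "mp_regular P"
    and "x \<in> carrier_vec n" and "vec_norm2 x = 1"
    and "mp_eval P lam *\<^sub>v x \<noteq> 0\<^sub>v n"
    and "M \<in> {spectral_norm, frobenius_norm}"
  shows
    "(\<forall>Le v. Le \<in> L1_space m n P \<and> Le \<in> T_even_matpolys 1 (m * n) \<and> is_linearization m n P Le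
        \<and> right_ansatz_vector m n P Le v \<and> vec_norm2 v = 1 \<and> v = Sigma_mat m *\<^sub>v v
        \<and> cmod lam \<le> 1 \<longrightarrow>
        sqrt ((real m + 1) / (2 * real m))
          \<le> structured_backward_error M (T_even_matpolys 1 (m * n)) 1 lam
                (kron_vec (Lambda_vec (m - 1) lam) x) Le / backward_error M m lam x P
      \<and> structured_backward_error M (T_even_matpolys 1 (m * n)) 1 lam
                (kron_vec (Lambda_vec (m - 1) lam) x) Le / backward_error M m lam x P
          \<le> sqrt 2)
   \<and> (\<forall>Lo v. Lo \<in> L1_space m n P \<and> Lo \<in> T_odd_matpolys 1 (m * n) \<and> is_linearization m n P Lo
        \<and> right_ansatz_vector m n P Lo v \<and> vec_norm2 v = 1 \<and> v = - (Sigma_mat m *\<^sub>v v)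
        \<and> cmod lam \<ge> 1 \<longrightarrow>
        sqrt ((real m + 1) / (2 * real m))
          \<le> structured_backward_error M (T_odd_matpolys 1 (m * n)) 1 lam
                (kron_vec (Lambda_vec (m - 1) lam) x) Lo / backward_error M m lam x P
      \<and> structured_backward_error M (T_odd_matpolys 1 (m * n)) 1 lam
                (kron_vec (Lambda_vec (m - 1) lam) x) Lo / backward_error M m lam x P
          \<le> sqrt 2)"
proof (intro conjI allI impI; elim conjE)
  have P: "P \<in> carrier_mat n n"
    using assms(3) by (simp add: T_even_matpolys_def matpolys_def)
  fix L v
  assume L: "L \<in> L1_space m n P" and v: "right_ansatz_vector m n P L v" "vec_norm2 v = 1"
  have L': "L \<in> carrier_mat (m * n) (m * n)"
    using L by (simp add: L1_space_def matpolys_def)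
  \<comment> \<open>One block for each parity; the bound on \<open>cmod lam\<close> is the one under
    which the matching perturbation exists.\<close>
  {
    assume z: "cmod lam \<le> 1"
    have "T_even_matpolys 1 (m * n) \<subseteq> matpolys 1 (m * n)"
      by (auto simp: T_even_matpolys_def)
    note bounds = backward_error_ratio_bounds[OF assms(8,1) P assms(5-7) L' v this]
    show "sqrt ((real m + 1) / (2 * real m))
          \<le> structured_backward_error M (T_even_matpolys 1 (m * n)) 1 lam
                (kron_vec (Lambda_vec (m - 1) lam) x) L / backward_error M m lam x P"
      and "structured_backward_error M (T_even_matpolys 1 (m * n)) 1 lam
                (kron_vec (Lambda_vec (m - 1) lam) x) L / backward_error M m lam x P \<le> sqrt 2"
      by (rule bounds, metis T_even_pencil_perturbation[OF assms(8) L' _ _ z])+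
  next
    assume z: "1 \<le> cmod lam"
    have "T_odd_matpolys 1 (m * n) \<subseteq> matpolys 1 (m * n)"
      by (auto simp: T_odd_matpolys_def)
    note bounds = backward_error_ratio_bounds[OF assms(8,1) P assms(5-7) L' v this]
    show "sqrt ((real m + 1) / (2 * real m))
          \<le> structured_backward_error M (T_odd_matpolys 1 (m * n)) 1 lam
                (kron_vec (Lambda_vec (m - 1) lam) x) L / backward_error M m lam x P"
      and "structured_backward_error M (T_odd_matpolys 1 (m * n)) 1 lam
                (kron_vec (Lambda_vec (m - 1) lam) x) L / backward_error M m lam x P \<le> sqrt 2"
      by (rule bounds, metis T_odd_pencil_perturbation[OF assms(8) L' _ _ z])+
  }
qed

end
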